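(* Let $(X,d)$ be a metric space and let $K \subseteq X$ be a closed subset of $X$ with $|K|>1$. Then, given any distinct $x,y \in K$, there exists a metric $\tilde d$ on $X$ which is bounded and topologically equivalent to $d$ such that $[x,y]_{\tilde d}=K$.
   Context: For a metric $\rho$ on a set $X$ and $x,y\in X$, the metric segment joining $x,y$ is $[x,y]_{\rho}=\{z\in X : \rho(x,z)+\rho(z,y)=\rho(x,y)\}$. Two metrics on $X$ are topologically equivalent if they induce the same topology on $X$. A metric $\rho$ on $X$ is bounded if $\sup_{p,q\in X}\rho(p,q)<\infty$. *)

theory Defs
  imports "HOL-Analysis.Analysis"
begin

definition metric_segment :: "'a set \<Rightarrow> ('a \<Rightarrow> 'a \<Rightarrow> real) \<Rightarrow> 'a \<Rightarrow> 'a \<Rightarrow> 'a set"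
  where "metric_segment X \<rho> x y = {z \<in> X. \<rho> x z + \<rho> z y = \<rho> x y}"

definition topologically_equivalent ::
    "'a set \<Rightarrow> ('a \<Rightarrow> 'a \<Rightarrow> real) \<Rightarrow> ('a \<Rightarrow> 'a \<Rightarrow> real) \<Rightarrow> bool"
  where "topologically_equivalent X \<rho> \<sigma> \<longleftrightarrow>
    Metric_space.mtopology X \<rho> = Metric_space.mtopology X \<sigma>"

text \<open>Finiteness of the supremum is expressed by \<^const>\<open>bdd_above\<close>, since
  \<^const>\<open>Sup\<close> on the reals always returns a real number, even for unbounded sets.\<close>

definition bounded_metric :: "'a set \<Rightarrow> ('a \<Rightarrow> 'a \<Rightarrow> real) \<Rightarrow> bool"
  where "bounded_metric X \<rho> \<longleftrightarrow> bdd_above {\<rho> p q | p q. p \<in> X \<and> q \<in> X}"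

end

theory Submission
  imports Defs
begin

text \<open>
  The new metric is built from \<open>d\<close> by three ingredients, with \<open>D = d x y > 0\<close>.

  \<^item> A bounded function \<open>f p = min D (d x p) - min D (d p y)\<close>, which equals \<open>-D\<close> only at \<open>x\<close> and \<open>D\<close> only
    at \<open>y\<close>. Under the pseudometric \<open>\<bar>f p - f q\<bar>\<close> every point lies between \<open>x\<close> and \<open>y\<close>, because the
    values of \<open>f\<close> lie between its values at \<open>x\<close> and \<open>y\<close>.

  \<^item> The pseudometric \<open>e p q = min (d p q) (w p + w q)\<close> with \<open>w p = min D (min (d x p) (d p y))\<close>, that is,
    \<open>d\<close> cut off by the cost of travelling through the pair \<open>{x, y}\<close> collapsed to one point. It detects
    the topology of \<open>d\<close> away from \<open>x\<close> and \<open>y\<close>, while \<open>f\<close> detects it at \<open>x\<close> and \<open>y\<close>. Its distances to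
    \<open>x\<close> and \<open>y\<close> never exceed those given by \<open>f\<close>, so the maximum of the two still places
    every point between \<open>x\<close> and \<open>y\<close>.

  \<^item> The pseudometric \<open>\<bar>g p - g q\<bar>\<close>, where \<open>g\<close> is the truncated distance to \<open>K\<close>. It is added to the
    maximum: since \<open>g\<close> vanishes at \<open>x\<close> and \<open>y\<close>, the detour through \<open>z\<close> becomes longer by \<open>2 * g z\<close>, and
    this is zero exactly for \<open>z \<in> K\<close>, as \<open>K\<close> is closed.

  All three are bounded and at most a constant times \<open>d\<close>, so the new metric is bounded and its topology
  is no finer than that of \<open>d\<close>; it is no coarser by the remark on \<open>e\<close> and \<open>f\<close>.
\<close>

text \<open>The lower bound need only hold with a truncation depending on the base point \<open>p\<close>, because being
  open is a condition on small balls around each point separately.\<close>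

lemma mtopology_eq_of_local_bounds:
  assumes M: "Metric_space M d" and M': "Metric_space M d'"
    and upper: "\<And>p q. \<lbrakk>p \<in> M; q \<in> M\<rbrakk> \<Longrightarrow> d' p q \<le> C * d p q"
    and lower: "\<And>p. p \<in> M \<Longrightarrow> \<exists>\<eta>>0. \<forall>q\<in>M. min \<eta> (d p q) \<le> d' p q"
  shows "Metric_space.mtopology M d' = Metric_space.mtopology M d"
proof -
  interpret A: Metric_space M d by fact
  interpret B: Metric_space M d' by fact
  have fine: "\<exists>s>0. A.mball p s \<subseteq> B.mball p r" if "p \<in> M" "r > 0" for p r
  proof (intro exI conjI)
    show "r / (\<bar>C\<bar> + 1) > 0" using that by simp
    show "A.mball p (r / (\<bar>C\<bar> + 1)) \<subseteq> B.mball p r"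
    proof
      fix q assume "q \<in> A.mball p (r / (\<bar>C\<bar> + 1))"
      then have q: "q \<in> M" "d p q < r / (\<bar>C\<bar> + 1)" by auto
      have "d' p q \<le> C * d p q" using upper that q by blast
      also have "\<dots> \<le> (\<bar>C\<bar> + 1) * d p q" by (intro mult_right_mono) auto
      also have "\<dots> < r" using q(2) by (simp add: pos_less_divide_eq mult.commute)
      finally show "q \<in> B.mball p r" using that q by simp
    qed
  qed
  have coarse: "\<exists>s>0. B.mball p s \<subseteq> A.mball p r" if p: "p \<in> M" and r: "r > 0" for p r
  proof -
    obtain \<eta> where "\<eta> > 0" and \<eta>: "\<And>q. q \<in> M \<Longrightarrow> min \<eta> (d p q) \<le> d' p q"
      using lower[OF p] by blast
    have "B.mball p (min \<eta> r) \<subseteq> A.mball p r"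
      using \<eta> by fastforce
    then show ?thesis using \<open>\<eta> > 0\<close> r by (intro exI[of _ "min \<eta> r"]) auto
  qed
  have "openin B.mtopology U \<longleftrightarrow> openin A.mtopology U" for U
    unfolding A.openin_mtopology B.openin_mtopology
    by (meson fine coarse subsetD subset_trans)
  then show ?thesis by (simp add: topology_eq)
qed

lemma (in Metric_space) closed_zero_set_of_Lipschitz:
  assumes K: "closedin mtopology K" and "K \<noteq> {}"
  obtains g :: "'a \<Rightarrow> real" where
    "\<And>p. 0 \<le> g p" "\<And>p. g p \<le> 1"
    "\<And>p q. \<lbrakk>p \<in> M; q \<in> M\<rbrakk> \<Longrightarrow> \<bar>g p - g q\<bar> \<le> d p q"
    "\<And>p. p \<in> M \<Longrightarrow> g p = 0 \<longleftrightarrow> p \<in> K"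
proof
  define h where "h p = (INF k\<in>K. d p k)" for p
  have KM: "K \<subseteq> M" using K closedin_subset by fastforce
  have bdd: "bdd_below ((\<lambda>k. d p k) ` K)" for p by (rule bdd_belowI[of _ 0]) auto
  have h0: "0 \<le> h p" for p
    unfolding h_def by (rule cINF_greatest) (use \<open>K \<noteq> {}\<close> in auto)
  have h_le: "h p \<le> d p q + h q" if "p \<in> M" "q \<in> M" for p q
  proof -
    have "h p - d p q \<le> d q k" if "k \<in> K" for k
    proof -
      have "h p \<le> d p k" unfolding h_def by (rule cINF_lower[OF bdd that])
      also have "\<dots> \<le> d p q + d q k" using triangle \<open>p \<in> M\<close> \<open>q \<in> M\<close> KM that by blast
      finally show ?thesis by simp
    qed
    then have "h p - d p q \<le> h q"
      unfolding h_def[of q] by (intro cINF_greatest \<open>K \<noteq> {}\<close>)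
    then show ?thesis by simp
  qed
  show "0 \<le> min 1 (h p)" "min 1 (h p) \<le> 1" for p using h0[of p] by auto
  show "\<bar>min 1 (h p) - min 1 (h q)\<bar> \<le> d p q" if "p \<in> M" "q \<in> M" for p q
    using h_le[OF that] h_le[OF that(2,1)] commute[of p q] nonneg[of p q] by linarith
  show "min 1 (h p) = 0 \<longleftrightarrow> p \<in> K" if p: "p \<in> M" for p
  proof
    assume "p \<in> K"
    then have "h p \<le> d p p" unfolding h_def by (intro cINF_lower[OF bdd])
    then show "min 1 (h p) = 0" using h0[of p] p by simp
  next
    assume eq: "min 1 (h p) = 0"
    show "p \<in> K"
    proof (rule ccontr)
      assume "p \<notin> K"
      then obtain r where "r > 0" and r: "disjnt K (mball p r)"
        using K p unfolding closedin_metric by blast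
      have "r \<le> d p k" if "k \<in> K" for k
        using r that p KM by (force simp: disjnt_iff not_less)
      then have "r \<le> h p" unfolding h_def by (intro cINF_greatest \<open>K \<noteq> {}\<close>)
      with \<open>r > 0\<close> eq show False by simp
    qed
  qed
qed

text \<open>If both distances on the right are cut off, the weights \<open>w p\<close> and \<open>w r\<close> alone already suffice; if only one
  is, the Lipschitz condition moves the weight at \<open>q\<close> to the other end of the uncut distance.\<close>

lemma (in Metric_space) collapse_triangle:
  assumes w: "\<And>p. 0 \<le> w p" "\<And>p q. \<lbrakk>p \<in> M; q \<in> M\<rbrakk> \<Longrightarrow> \<bar>w p - w q\<bar> \<le> d p q"
    and "p \<in> M" "q \<in> M" "r \<in> M"
  shows "min (d p r) (w p + w r) \<le> min (d p q) (w p + w q) + min (d q r) (w q + w r)"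
  using triangle[of p q r] w(1)[of q] w(2)[of p q] w(2)[of q r] assms(3-5) by linarith

theorem theorem2p10:
  fixes X K :: "'a set" and d :: "'a \<Rightarrow> 'a \<Rightarrow> real"
  assumes "Metric_space X d"
    and "K \<subseteq> X"
    and "closedin (Metric_space.mtopology X d) K"
    and "infinite K \<or> card K > 1"
  shows "\<forall>x\<in>K. \<forall>y\<in>K. x \<noteq> y \<longrightarrow>
    (\<exists>d' :: 'a \<Rightarrow> 'a \<Rightarrow> real. Metric_space X d' \<and> bounded_metric X d' \<and>
       topologically_equivalent X d' d \<and> metric_segment X d' x y = K)"
proof (intro ballI impI)
  fix x y assume xK: "x \<in> K" and yK: "y \<in> K" and "x \<noteq> y"
  interpret Metric_space X d by fact
  have x: "x \<in> X" and y: "y \<in> X" using xK yK \<open>K \<subseteq> X\<close> by auto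
  obtain g :: "'a \<Rightarrow> real" where g: "\<And>p. 0 \<le> g p" "\<And>p. g p \<le> 1"
    and g_Lip: "\<And>p q. \<lbrakk>p \<in> X; q \<in> X\<rbrakk> \<Longrightarrow> \<bar>g p - g q\<bar> \<le> d p q"
    and g_0: "\<And>p. p \<in> X \<Longrightarrow> g p = 0 \<longleftrightarrow> p \<in> K"
    using closed_zero_set_of_Lipschitz[OF assms(3)] xK by blast
  define D where "D = d x y"
  have D: "D > 0" unfolding D_def using x y \<open>x \<noteq> y\<close> by simp
  define f where "f p = min D (d x p) - min D (d p y)" for p
  define w where "w p = min D (min (d x p) (d p y))" for p
  define e where "e p q = min (d p q) (w p + w q)" for p q
  define d' where "d' p q = max \<bar>f p - f q\<bar> (e p q) + \<bar>g p - g q\<bar>" for p q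

  have f_ends: "f x = - D" "f y = D"
    unfolding f_def using D x y by (auto simp: D_def)
  have f_range: "\<bar>f p\<bar> \<le> D" for p
    unfolding f_def using D nonneg[of x p] nonneg[of p y] by linarith
  have w: "0 \<le> w p" "w p \<le> D" for p
    unfolding w_def using D by auto
  have dist_Lip: "\<bar>d x p - d x q\<bar> \<le> d p q" "\<bar>d p y - d q y\<bar> \<le> d p q" if "p \<in> X" "q \<in> X" for p q
    using triangle[of x p q] triangle[of x q p] triangle[of p q y] triangle[of q p y]
      commute[of p q] x y that by linarith+
  have f_Lip: "\<bar>f p - f q\<bar> \<le> 2 * d p q" if "p \<in> X" "q \<in> X" for p q
    unfolding f_def using dist_Lip[OF that] by linarith
  have w_Lip: "\<bar>w p - w q\<bar> \<le> d p q" if "p \<in> X" "q \<in> X" for p q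
    unfolding w_def using dist_Lip[OF that] by linarith
  have e_nonneg: "0 \<le> e p q" for p q
    unfolding e_def using w(1)[of p] w(1)[of q] by simp
  have e_triangle: "e p r \<le> e p q + e q r" if "p \<in> X" "q \<in> X" "r \<in> X" for p q r
    unfolding e_def by (rule collapse_triangle[OF w(1) w_Lip that])

  have lower: "\<exists>\<eta>>0. \<forall>q\<in>X. min \<eta> (d p q) \<le> d' p q" if p: "p \<in> X" for p
  proof -
    consider "p = x" | "p = y" | "p \<noteq> x" "p \<noteq> y" by blast
    then show ?thesis
    proof cases
      case 1
      have "min D (d x q) \<le> \<bar>f x - f q\<bar>" for q
        using f_ends(1) D unfolding f_def[of q] by linarith
      then have "min D (d x q) \<le> d' x q" for q
        unfolding d'_def by (smt (verit))
      then show ?thesis unfolding 1 using D by blast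
    next
      case 2
      have "min D (d y q) \<le> \<bar>f y - f q\<bar>" for q
        using f_ends(2) D commute[of q y] unfolding f_def[of q] by linarith
      then have "min D (d y q) \<le> d' y q" for q
        unfolding d'_def by (smt (verit))
      then show ?thesis unfolding 2 using D by blast
    next
      case 3
      then have "w p > 0" unfolding w_def using D p x y by auto
      moreover have "min (w p) (d p q) \<le> d' p q" for q
        unfolding d'_def e_def using w(1)[of q] by linarith
      ultimately show ?thesis by blast
    qed
  qed

  have M': "Metric_space X d'"
  proof
    show "0 \<le> d' p q" for p q
      unfolding d'_def by linarith
    show "d' p q = d' q p" for p q
      unfolding d'_def e_def by (simp add: abs_minus_commute commute add.commute)
    show "d' p q = 0 \<longleftrightarrow> p = q" if "p \<in> X" "q \<in> X" for p q
    proof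
      assume "d' p q = 0"
      then have "d p q = 0"
        using lower[OF that(1)] that nonneg[of p q] by (smt (verit))
      then show "p = q" using that by simp
    next
      assume "p = q"
      then show "d' p q = 0" unfolding d'_def e_def using that w(1)[of q] by simp
    qed
    show "d' p r \<le> d' p q + d' q r" if "p \<in> X" "q \<in> X" "r \<in> X" for p q r
      unfolding d'_def using e_triangle[OF that] by linarith
  qed

  have bounded: "bounded_metric X d'"
  proof -
    have "d' p q \<le> 2 * D + 1" for p q
      unfolding d'_def e_def using f_range[of p] f_range[of q] w[of p] w[of q] g[of p] g[of q]
      by linarith
    then show ?thesis unfolding bounded_metric_def by (intro bdd_aboveI[of _ "2 * D + 1"]) auto
  qed

  have "d' p q \<le> 3 * d p q" if "p \<in> X" "q \<in> X" for p q
    unfolding d'_def e_def using f_Lip[OF that] g_Lip[OF that] nonneg[of p q] by linarith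
  then have equiv: "topologically_equivalent X d' d"
    unfolding topologically_equivalent_def
    by (intro mtopology_eq_of_local_bounds[OF assms(1) M' _ lower]) auto

  have w_ends: "w x = 0" "w y = 0"
    unfolding w_def using D x y by auto
  have g_ends: "g x = 0" "g y = 0"
    using g_0 x y xK yK by auto
  \<comment> \<open>At the endpoints, \<open>f\<close> dominates \<open>e\<close>, so only \<open>f\<close> and \<open>g\<close> contribute.\<close>
  have d'_x: "d' x z = (f z + D) + g z" for z
  proof -
    have "e x z \<le> w z" unfolding e_def w_ends by simp
    also have "\<dots> \<le> f z + D" unfolding w_def f_def by linarith
    finally show ?thesis
      unfolding d'_def f_ends g_ends using f_range[of z] g(1)[of z] by linarith
  qed
  have d'_y: "d' z y = (D - f z) + g z" for z
  proof -
    have "e z y \<le> w z" unfolding e_def w_ends by simp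
    also have "\<dots> \<le> D - f z" unfolding w_def f_def by linarith
    finally show ?thesis
      unfolding d'_def f_ends g_ends using f_range[of z] g(1)[of z] by linarith
  qed
  have "d' x z + d' z y = d' x y \<longleftrightarrow> g z = 0" for z
    unfolding d'_x d'_y f_ends g_ends by auto
  then have "metric_segment X d' x y = K"
    unfolding metric_segment_def using g_0 \<open>K \<subseteq> X\<close> by auto
  with M' bounded equiv
  show "\<exists>d'. Metric_space X d' \<and> bounded_metric X d' \<and>
      topologically_equivalent X d' d \<and> metric_segment X d' x y = K"
    by blast
qed

end
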